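(* Let $K>0$ and let $f:[0,\infty)\to[0,\infty)$ be continuous with $f(0)=0$, $f(K)=K$ and $f(x)>x$ for all $x\in(0,K)$. Let $\gamma_n=(-1)^n\beta_n$, $n\in\mathbb N$, where $\beta_n>0$ for all $n\in\mathbb N$ and $\lim_{n\to\infty}\gamma_n=0$. Assume that for some $\bar\delta>0$ $$f(x+a)-f(x)>a\quad\text{for all }x,a\in(0,\bar\delta),$$ and that $$f(\beta_{2k})>\beta_{2k+1}\quad\text{for all sufficiently large }k\in\mathbb N.$$ Then no solution $(x_n)$, with $x_0>0$, of $$x_{n+1}=\max\{f(x_n)+\gamma_{n+1},0\},\quad n=0,1,\dots,$$ converges to $0$; that is, it is not the case that $\lim_{n\to\infty}x_n=0$.
   Context: $\mathbb N=\{1,2,\dots\}$. *)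

theory Defs
  imports Complex_Main "HOL-Library.FuncSet"
begin

end

theory Submission
  imports Defs
begin

text \<open>
  Since \<open>x\<^sub>2\<^sub>k = \<beta>\<^sub>2\<^sub>k + f(x\<^sub>2\<^sub>k\<^sub>-\<^sub>1)\<close>, the superadditivity-type condition near \<open>0\<close> gives
  \<open>f(x\<^sub>2\<^sub>k) \<ge> f(\<beta>\<^sub>2\<^sub>k) + f(x\<^sub>2\<^sub>k\<^sub>-\<^sub>1)\<close> as long as the solution is small, hence
  \<open>x\<^sub>2\<^sub>k\<^sub>+\<^sub>1 \<ge> f(x\<^sub>2\<^sub>k\<^sub>-\<^sub>1) + (f(\<beta>\<^sub>2\<^sub>k) - \<beta>\<^sub>2\<^sub>k\<^sub>+\<^sub>1) > x\<^sub>2\<^sub>k\<^sub>-\<^sub>1\<close>.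
  So the odd-indexed terms, which are nonnegative, eventually increase strictly and cannot tend to \<open>0\<close>.
\<close>

theorem proposition3p6:
  fixes K \<delta> :: real and f :: "real \<Rightarrow> real" and \<beta> \<gamma> :: "nat \<Rightarrow> real"
  assumes "K > 0"
    and "f \<in> {0..} \<rightarrow> {0..}"
    and "continuous_on {0..} f"
    and "f 0 = 0"
    and "f K = K"
    and "\<And>x. x \<in> {0<..<K} \<Longrightarrow> f x > x"
    and "\<And>n. n \<ge> 1 \<Longrightarrow> \<gamma> n = (-1) ^ n * \<beta> n"
    and "\<And>n. n \<ge> 1 \<Longrightarrow> \<beta> n > 0"
    and "\<gamma> \<longlonglongrightarrow> 0"
    and "\<delta> > 0"
    and "\<And>x a. x \<in> {0<..<\<delta>} \<Longrightarrow> a \<in> {0<..<\<delta>} \<Longrightarrow> f (x + a) - f x > a"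
    and "\<forall>\<^sub>F k in sequentially. f (\<beta> (2 * k)) > \<beta> (2 * k + 1)"
  shows "\<not> (\<exists>x :: nat \<Rightarrow> real. x 0 > 0 \<and>
           (\<forall>n. x (n + 1) = max (f (x n) + \<gamma> (n + 1)) 0) \<and> x \<longlonglongrightarrow> 0)"
proof
  assume "\<exists>x :: nat \<Rightarrow> real. x 0 > 0 \<and>
    (\<forall>n. x (n + 1) = max (f (x n) + \<gamma> (n + 1)) 0) \<and> x \<longlonglongrightarrow> 0"
  then obtain x :: "nat \<Rightarrow> real"
    where rec: "\<And>n. x (Suc n) = max (f (x n) + \<gamma> (Suc n)) 0" and lim: "x \<longlonglongrightarrow> 0"
    by auto
  have pos: "x (Suc n) \<ge> 0" for n
    by (simp add: rec)
  \<comment> \<open>Below \<open>K\<close> the bound \<open>f x > x\<close> applies; below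
    \<open>\<delta>\<close> the increment condition does.\<close>
  have "\<forall>\<^sub>F n in sequentially. x n < min \<delta> K"
    using order_tendstoD(2)[OF lim, of "min \<delta> K"] assms(1,10) by simp
  then obtain N where N: "\<And>n. n \<ge> N \<Longrightarrow> x n < min \<delta> K"
    unfolding eventually_sequentially by blast
  obtain M where M: "\<And>k. k \<ge> M \<Longrightarrow> f (\<beta> (2 * k)) > \<beta> (2 * k + 1)"
    using assms(12) unfolding eventually_sequentially by blast
  define y where "y j = x (2 * (N + M + j) + 1)" for j
  have "y j < y (Suc j)" for j
  proof -
    define k where "k = N + M + j + 1"
    have k: "k \<ge> 1" "k \<ge> M" "2 * k - 1 \<ge> N" "2 * k \<ge> N"
      by (auto simp: k_def)
    have y: "y j = x (2 * k - 1)" "y (Suc j) = x (2 * k + 1)"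
      by (auto simp: y_def k_def)
    have yj: "0 \<le> y j" "y j < K"
      using pos[of "2 * (N + M + j)"] N[OF k(3)] by (simp add: y_def, simp add: y)
    \<comment> \<open>Equality can occur: the truncation by \<open>max\<close> may make
      \<open>y j\<close> zero.\<close>
    have fy: "y j \<le> f (y j)"
      using assms(6)[of "y j"] assms(4) yj by (cases "y j = 0") auto
    have \<beta>: "\<beta> (2 * k) > 0"
      using assms(8)[of "2 * k"] k by simp
    have even: "x (2 * k) = \<beta> (2 * k) + f (y j)"
      using rec[of "2 * k - 1"] assms(7)[of "2 * k"] k(1) \<beta> fy yj(1) by (simp add: y max_def)
    \<comment> \<open>Both are nonnegative summands of \<open>x (2 * k) < \<delta>\<close>.\<close>
    then have small: "\<beta> (2 * k) < \<delta>" "f (y j) < \<delta>"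
      using N[OF k(4)] \<beta> fy yj(1) by auto
    \<comment> \<open>The base point is \<open>\<beta> (2 * k)\<close> and the increment
      \<open>f (y j)\<close>; a zero increment gives equality.\<close>
    have "f (\<beta> (2 * k)) + f (y j) \<le> f (x (2 * k))"
      using assms(11)[of "\<beta> (2 * k)" "f (y j)"] \<beta> small fy yj(1) even
      by (cases "f (y j) = 0") auto
    moreover have "x (2 * k + 1) \<ge> f (x (2 * k)) - \<beta> (2 * k + 1)"
      using rec[of "2 * k"] assms(7)[of "2 * k + 1"] by simp
    ultimately show ?thesis
      using M[OF k(2)] fy by (simp add: y)
  qed
  then have "strict_mono y"
    by (simp add: strict_mono_Suc_iff)
  moreover have "y \<longlonglongrightarrow> 0"
    using LIMSEQ_subseq_LIMSEQ[OF lim, of "\<lambda>j. 2 * (N + M + j) + 1"]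
    by (simp add: y_def[abs_def] o_def strict_mono_def)
  \<comment> \<open>An increasing sequence stays below its limit, which forces
    \<open>y 0 < 0\<close>.\<close>
  ultimately have "y 1 \<le> 0" "y 0 < y 1"
    by (auto intro: incseq_le strict_mono_mono simp: strict_mono_less)
  then show False
    using pos[of "2 * (N + M)"] by (simp add: y_def)
qed

end
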